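(* Let $N>1$, let $s\in\mathbb{N}$ with $1\le s<N/2$, and let $\bm{A}$ be an $m\times N$ real matrix. For $R:\mathbb{R}^N\to[0,\infty)$ and $\bm{x}\in\mathbb{R}^N$ consider the problem $$(\mathrm{P}_R)\qquad \underset{\bm{z}\in\mathbb{R}^N}{\text{minimize}}\ R(\bm{z})\quad\text{subject to}\quad \bm{A}\bm{z}=\bm{A}\bm{x}.$$ (i) The two-level $\ell_1$ penalty $R_{2\ell_1}$ and the sorted $\ell_1$ penalty $R_{s\ell_1}$ with $\beta_{s+1}>0$ are at least as good as $\ell_1$-minimization in recovering sparse vectors, in the following sense. Let $R$ be either of these penalties. If the null space property $$\ker(\bm{A})\setminus\{\mathbf{0}\}\subset\big\{\bm{v}\in\mathbb{R}^N:\ \|\bm{v}_S\|_1<\|\bm{v}_{\overline{S}}\|_1\ \ \forall S\subset\{1,\ldots,N\}\text{ with }\#(S)\le s\big\}$$ holds, then every $s$-sparse vector $\bm{x}\in\mathbb{R}^N$ is the unique solution to $(\mathrm{P}_R)$. (ii) The $\ell_1-\ell_2$ penalty $R_{\ell_1-\ell_2}$ and the sorted $\ell_1$ penalty $R_{s\ell_1}$ with $\beta_{s+1}>\beta_s$ are provably superior to $\ell_1$-minimization in recovering sparse vectors, in the following sense. Let $R$ be either of these penalties. If the improved null space property $$\ker(\bm{A})\setminus\{\mathbf{0}\}\subset\big\{\bm{v}\in\mathbb{R}^N:\ \|\bm{v}_S\|_1\le\|\bm{v}_{\overline{S}}\|_1\ \ \forall S\subset\{1,\ldots,N\}\text{ with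 }\#(S)\le s\big\}$$ holds, then every $s$-sparse vector $\bm{x}\in\mathbb{R}^N$ that is not an equal-height vector is the unique solution to $(\mathrm{P}_R)$.
   Context: For $\bm{v}\in\mathbb{R}^N$ and $S\subset\{1,\ldots,N\}$: $\overline{S}$ is the complement of $S$ in $\{1,\ldots,N\}$, $\#(S)$ is the cardinality of $S$, and $\bm{v}_S\in\mathbb{R}^N$ is the vector that agrees with $\bm{v}$ on the coordinates in $S$ and is zero on the coordinates in $\overline{S}$. A vector is $s$-sparse if it has at most $s$ nonzero coordinates. A vector is equal-height if all its nonzero coordinates have the same magnitude (the zero vector is, vacuously, equal-height). "$\bm{x}$ is the unique solution to $(\mathrm{P}_R)$" means that $R(\bm{z})>R(\bm{x})$ for every $\bm{z}\ne\bm{x}$ with $\bm{A}\bm{z}=\bm{A}\bm{x}$. $\ell_1$-minimization is the problem $(\mathrm{P}_R)$ with $R(\bm{z})=\|\bm{z}\|_1$; the null space property in (i) is the necessary and sufficient condition for it to recover all $s$-sparse vectors. For $\bm{z}\in\mathbb{R}^N$ let $|z|_{[1]}\ge\cdots\ge|z|_{[N]}$ be the numbers $|z_1|,\ldots,|z_N|$ arranged in decreasing order. The penalties are: - $\ell_1-\ell_2$: $R_{\ell_1-\ell_2}(\bm{z})=\|\bm{z}\|_1-\|\bm{z}\|_2$. - Two-level $\ell_1$: $R_{2\ell_1}(\bm{z})=\rho\sum_{j\in J(\bm{z})}|z_j|+\sum_{j\in J(\bm{z})^c}|z_j|$, where $0\le\rho<1$ is a fixed constant and $J(\bm{z})$ is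 the set of indices of the $K$ largest values among $|z_1|,\ldots,|z_N|$, for a fixed integer $0\le K\le N$ not depending on $\bm{z}$ (ties broken arbitrarily; the value of $R_{2\ell_1}$ does not depend on the choice). - Sorted $\ell_1$: $R_{s\ell_1}(\bm{z})=\beta_1|z|_{[1]}+\cdots+\beta_N|z|_{[N]}$, where $0\le\beta_1\le\cdots\le\beta_N$ are fixed constants (the letter $s$ in the name $R_{s\ell_1}$ stands for "sorted" and is unrelated to the sparsity $s$).
   Formalization: For the two-level penalty in (i), the formal statement also assumes ρ > 0 or K ≤ s; without this the claim fails: N=3, s=1, ρ=0, K=2, ker A spanned by (1,1,1): x=(1,0,0) and z=(0,-1,-1) are both feasible with penalty 0. *)

theory Defs
  imports "HOL-Analysis.Analysis" "HOL-Library.Multiset"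
begin

text \<open>
  Vectors in \<open>\<real>\<^sup>N\<close> are of type \<open>real ^ 'n\<close> with \<open>N = CARD('n)\<close>, so the index set
  \<open>{1, \<dots>, N}\<close> is \<open>UNIV :: 'n set\<close>.
\<close>

definition l1_norm :: "real ^ 'n \<Rightarrow> real" where
  "l1_norm v = (\<Sum>i\<in>UNIV. \<bar>v $ i\<bar>)"

definition vrestrict :: "real ^ 'n \<Rightarrow> 'n set \<Rightarrow> real ^ 'n" where
  "vrestrict v S = (\<chi> i. if i \<in> S then v $ i else 0)"

definition matrix_ker :: "real ^ 'n ^ 'm \<Rightarrow> (real ^ 'n) set" where
  "matrix_ker A = {v. A *v v = 0}"

definition is_sparse :: "nat \<Rightarrow> real ^ 'n \<Rightarrow> bool" where
  "is_sparse s x \<longleftrightarrow> card {i. x $ i \<noteq> 0} \<le> s"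

definition equal_height :: "real ^ 'n \<Rightarrow> bool" where
  "equal_height x \<longleftrightarrow> (\<forall>i j. x $ i \<noteq> 0 \<longrightarrow> x $ j \<noteq> 0 \<longrightarrow> \<bar>x $ i\<bar> = \<bar>x $ j\<bar>)"

definition unique_solution ::
    "real ^ 'n ^ 'm \<Rightarrow> (real ^ 'n \<Rightarrow> real) \<Rightarrow> real ^ 'n \<Rightarrow> bool" where
  "unique_solution A R x \<longleftrightarrow> (\<forall>z. z \<noteq> x \<longrightarrow> A *v z = A *v x \<longrightarrow> R z > R x)"

definition null_space_property :: "nat \<Rightarrow> real ^ 'n ^ 'm \<Rightarrow> bool" where
  "null_space_property s A \<longleftrightarrow>
     matrix_ker A - {0} \<subseteq>
       {v. \<forall>S. card S \<le> s \<longrightarrow> l1_norm (vrestrict v S) < l1_norm (vrestrict v (- S))}"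

definition improved_null_space_property :: "nat \<Rightarrow> real ^ 'n ^ 'm \<Rightarrow> bool" where
  "improved_null_space_property s A \<longleftrightarrow>
     matrix_ker A - {0} \<subseteq>
       {v. \<forall>S. card S \<le> s \<longrightarrow> l1_norm (vrestrict v S) \<le> l1_norm (vrestrict v (- S))}"

definition l1_minus_l2 :: "real ^ 'n \<Rightarrow> real" where
  "l1_minus_l2 z = l1_norm z - norm z"

text \<open>
  \<open>largest_indices K z J\<close>: \<open>J\<close> consists of the indices of the \<open>K\<close> largest values among the
  \<open>\<bar>z $ i\<bar>\<close>. Because of ties \<open>J\<close> need not be unique.
\<close>

definition largest_indices :: "nat \<Rightarrow> real ^ 'n \<Rightarrow> 'n set \<Rightarrow> bool" where
  "largest_indices K z J \<longleftrightarrow>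
     card J = K \<and> (\<forall>i\<in>J. \<forall>j\<in>- J. \<bar>z $ j\<bar> \<le> \<bar>z $ i\<bar>)"

lemma largest_indices_exists:
  fixes z :: "real ^ 'n"
  assumes "K \<le> CARD('n)"
  shows "\<exists>J. largest_indices K z J"
  using assms
proof (induction K)
  case 0
  show ?case by (auto simp: largest_indices_def intro!: exI[of _ "{}"])
next
  case (Suc K)
  then obtain J where J: "card J = K" "\<And>i j. i \<in> J \<Longrightarrow> j \<notin> J \<Longrightarrow> \<bar>z $ j\<bar> \<le> \<bar>z $ i\<bar>"
    by (auto simp: largest_indices_def)
  have "J \<noteq> UNIV" using J Suc.prems by auto
  then have ne: "- J \<noteq> {}" by auto
  define M where "M = Max ((\<lambda>j. \<bar>z $ j\<bar>) ` (- J))"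
  have "M \<in> (\<lambda>j. \<bar>z $ j\<bar>) ` (- J)" unfolding M_def by (rule Max_in) (use ne in auto)
  then obtain k where k: "k \<notin> J" "\<bar>z $ k\<bar> = M" by auto
  have "\<bar>z $ j\<bar> \<le> \<bar>z $ k\<bar>" if "j \<notin> J" for j
    using that unfolding k(2) M_def by (intro Max_ge) auto
  then have "largest_indices (Suc K) z (insert k J)"
    using J k(1) by (auto simp: largest_indices_def)
  then show ?case by blast
qed

text \<open>
  The tie-breaking rule is the parameter \<open>J\<close>, to be constrained by \<open>largest_indices K z (J z)\<close>
  for all \<open>z\<close>. This penalty is the sorted \<open>\<ell>\<^sub>1\<close> penalty with weights
  \<open>\<beta>\<^sub>1 = \<dots> = \<beta>\<^sub>K = \<rho>\<close> and \<open>\<beta>\<^sub>k = 1\<close> for \<open>k > K\<close>, so for it the condition \<open>\<beta> (s + 1) > 0\<close>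
  reads \<open>0 < \<rho> \<or> K \<le> s\<close>. Without that condition it need not recover sparse vectors: for
  \<open>N = 3\<close>, \<open>s = 1\<close>, \<open>\<rho> = 0\<close>, \<open>K = 2\<close> and a matrix with kernel spanned by \<open>(1, 1, 1)\<close>, the null
  space property holds, but \<open>(1, 0, 0)\<close> and \<open>(0, -1, -1)\<close> are both feasible with penalty \<open>0\<close>.
\<close>

definition two_level_l1 :: "real \<Rightarrow> (real ^ 'n \<Rightarrow> 'n set) \<Rightarrow> real ^ 'n \<Rightarrow> real" where
  "two_level_l1 \<rho> J z = \<rho> * (\<Sum>j\<in>J z. \<bar>z $ j\<bar>) + (\<Sum>j\<in>- J z. \<bar>z $ j\<bar>)"

text \<open>
  \<open>decr_mag z k\<close> is \<open>|z|\<^sub>[\<^sub>k\<^sub>]\<close>, the \<open>k\<close>-th largest magnitude counted with multiplicity, for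
  \<open>k \<in> {1..N}\<close> (hence the index shift into the list).
\<close>

definition decr_mag :: "real ^ 'n \<Rightarrow> nat \<Rightarrow> real" where
  "decr_mag z k =
     rev (sorted_list_of_multiset (image_mset (\<lambda>i. \<bar>z $ i\<bar>) (mset_set UNIV))) ! (k - 1)"

definition sorted_l1 :: "(nat \<Rightarrow> real) \<Rightarrow> real ^ 'n \<Rightarrow> real" where
  "sorted_l1 \<beta> z = (\<Sum>k = 1..CARD('n). \<beta> k * decr_mag z k)"

end

theory Submission
  imports Defs
begin

text \<open>
  Let \<open>z\<close> be feasible for the \<open>s\<close>-sparse vector \<open>x\<close>. An exchange argument, in which the null space
  property of \<open>v = z - x\<close> is applied either to an \<open>s\<close>-set \<open>S\<close> containing the support of \<open>x\<close> or to
  such a set with some of its elements swapped for large coordinates of \<open>z\<close> outside \<open>S\<close>, shows that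
  after removal of the \<open>j\<close> largest magnitudes the remaining \<open>\<ell>\<^sub>1\<close> mass of \<open>z\<close> dominates that of \<open>x\<close>.
  Sorted \<open>\<ell>\<^sub>1\<close> penalties are nonnegative combinations of these tail masses, which settles (i).
  For (ii), the improved null space property is compatible with an \<open>s\<close>-sparse \<open>z \<noteq> x\<close> only if \<open>v\<close> is
  equal-height with exactly \<open>2s\<close> nonzero coordinates, which makes \<open>x\<close> equal-height as well. Otherwise
  the tail of \<open>z\<close> beyond \<open>s\<close> is positive, and that gives the strict inequality; for
  \<open>\<ell>\<^sub>1 - \<ell>\<^sub>2\<close> one linearizes the penalty at \<open>z\<close>, which yields a sorted \<open>\<ell>\<^sub>1\<close> penalty, and strictness
  comes from Cauchy-Schwarz.
\<close>

section \<open>Decreasing rearrangement and tail masses\<close>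

lemma l1_norm_vrestrict: "l1_norm (vrestrict v S) = (\<Sum>i\<in>S. \<bar>v $ i\<bar>)"
proof -
  have "l1_norm (vrestrict v S) = (\<Sum>i\<in>UNIV. if i \<in> S then \<bar>v $ i\<bar> else 0)"
    unfolding l1_norm_def vrestrict_def by (intro sum.cong) auto
  also have "\<dots> = (\<Sum>i\<in>S. \<bar>v $ i\<bar>)"
    by (simp add: sum.If_cases)
  finally show ?thesis .
qed

text \<open>The error of the best \<open>j\<close>-term approximation of \<open>z\<close> measured
  by \<open>l1_norm\<close>. The index \<open>j\<close> counts the removed magnitudes, so the sum
  starts at rank \<open>Suc j\<close>.\<close>

definition tail_mag :: "nat \<Rightarrow> real ^ 'n \<Rightarrow> real" where
  "tail_mag j z = (\<Sum>k = Suc j..CARD('n). decr_mag z k)"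

text \<open>Sorting the indices instead of their magnitudes turns the list lookup in
  \<open>decr_mag\<close> into a coordinate of \<open>z\<close>, so that sums over ranks can be
  reindexed as sums over coordinates.\<close>

lemma decr_mag_enumeration:
  fixes z :: "real ^ 'n"
  obtains \<sigma> where "bij_betw \<sigma> {1..CARD('n)} UNIV"
    and "\<And>k. 1 \<le> k \<Longrightarrow> k \<le> CARD('n) \<Longrightarrow> decr_mag z k = \<bar>z $ \<sigma> k\<bar>"
    and "\<And>k l. 1 \<le> k \<Longrightarrow> k \<le> l \<Longrightarrow> l \<le> CARD('n) \<Longrightarrow> \<bar>z $ \<sigma> l\<bar> \<le> \<bar>z $ \<sigma> k\<bar>"
proof -
  let ?f = "\<lambda>i. \<bar>z $ i\<bar>"
  obtain ys :: "'n list" where ys: "set ys = UNIV" "distinct ys"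
    using finite_distinct_list[OF finite, of "UNIV :: 'n set"] by auto
  define xs where "xs = sort_key ?f ys"
  have xs: "set xs = UNIV" "distinct xs" "sorted (map ?f xs)"
    using ys by (auto simp: xs_def)
  have len: "length xs = CARD('n)"
    using distinct_card[OF xs(2)] xs(1) by simp
  have "mset_set (UNIV :: 'n set) = mset xs"
    using mset_set_set[OF xs(2)] xs(1) by simp
  then have "sorted_list_of_multiset (image_mset ?f (mset_set UNIV)) = sort (map ?f xs)"
    by (metis mset_map sorted_list_of_multiset_mset)
  also have "\<dots> = map ?f xs"
    using xs(3) by (simp add: sorted_sort_id)
  finally have eq: "decr_mag z k = map ?f (rev xs) ! (k - 1)" for k
    by (simp add: decr_mag_def rev_map)
  define \<sigma> where "\<sigma> k = rev xs ! (k - 1)" for k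
  have "bij_betw ((!) (rev xs)) {..<CARD('n)} UNIV"
    using bij_betw_nth[of "rev xs" "{..<CARD('n)}" UNIV] xs len by simp
  moreover have "bij_betw (\<lambda>k. k - 1) {1..CARD('n)} {..<CARD('n)}"
    by (rule bij_betwI[where g = Suc]) auto
  ultimately have bij: "bij_betw \<sigma> {1..CARD('n)} UNIV"
    using bij_betw_trans unfolding \<sigma>_def comp_def by fastforce
  have val: "decr_mag z k = \<bar>z $ \<sigma> k\<bar>" if "1 \<le> k" "k \<le> CARD('n)" for k
    unfolding eq \<sigma>_def by (subst nth_map) (use that len in auto)
  have mono: "\<bar>z $ \<sigma> l\<bar> \<le> \<bar>z $ \<sigma> k\<bar>" if "1 \<le> k" "k \<le> l" "l \<le> CARD('n)" for k l
  proof -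
    have "rev (rev (map ?f xs)) = map ?f xs" by simp
    then have "map ?f (rev xs) ! (l - 1) \<le> map ?f (rev xs) ! (k - 1)"
      using xs(3) sorted_rev_nth_mono[of "map ?f (rev xs)" "k - 1" "l - 1"] that len
      by (simp add: rev_map)
    then show ?thesis using that len by (simp add: \<sigma>_def nth_map)
  qed
  show ?thesis using that[OF bij val mono] by blast
qed

lemma decr_mag_antimono:
  fixes z :: "real ^ 'n"
  assumes "1 \<le> k" "k \<le> l" "l \<le> CARD('n)"
  shows "decr_mag z l \<le> decr_mag z k"
proof -
  obtain \<sigma> where "bij_betw \<sigma> {1..CARD('n)} UNIV"
    "\<And>k. 1 \<le> k \<Longrightarrow> k \<le> CARD('n) \<Longrightarrow> decr_mag z k = \<bar>z $ \<sigma> k\<bar>"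
    "\<And>k l. 1 \<le> k \<Longrightarrow> k \<le> l \<Longrightarrow> l \<le> CARD('n) \<Longrightarrow> \<bar>z $ \<sigma> l\<bar> \<le> \<bar>z $ \<sigma> k\<bar>"
    by (rule decr_mag_enumeration[of z]) blast
  then show ?thesis using assms by (metis le_trans)
qed

text \<open>\<open>T - J\<close> and \<open>J - T\<close> are equinumerous, and each index of the
  latter has at least the magnitude of each index of the former; the common part of the two
  complements cancels.\<close>

lemma sum_complement_largest_indices_le:
  fixes z :: "real ^ 'n"
  assumes "largest_indices K z J" and "card T = K"
  shows "(\<Sum>i\<in>- J. \<bar>z $ i\<bar>) \<le> (\<Sum>i\<in>- T. \<bar>z $ i\<bar>)"
proof -
  have J: "card J = K" "\<And>i j. i \<in> J \<Longrightarrow> j \<notin> J \<Longrightarrow> \<bar>z $ j\<bar> \<le> \<bar>z $ i\<bar>"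
    using assms(1) by (auto simp: largest_indices_def)
  have "card (T - J) = card (J - T)"
    using J(1) assms(2) by (metis card_Diff_subset_Int finite Int_commute)
  then obtain h where h: "bij_betw h (T - J) (J - T)"
    using finite_same_card_bij by (metis finite)
  have "(\<Sum>i\<in>T - J. \<bar>z $ i\<bar>) \<le> (\<Sum>i\<in>T - J. \<bar>z $ h i\<bar>)"
    using h by (intro sum_mono J(2)) (auto dest: bij_betwE)
  also have "\<dots> = (\<Sum>i\<in>J - T. \<bar>z $ i\<bar>)"
    by (rule sum.reindex_bij_betw[OF h])
  finally have le: "(\<Sum>i\<in>T - J. \<bar>z $ i\<bar>) \<le> (\<Sum>i\<in>J - T. \<bar>z $ i\<bar>)" .
  have "- J \<inter> T = T - J" "- T \<inter> J = J - T" "- T - J = - J - T" by auto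
  then have "(\<Sum>i\<in>- J. \<bar>z $ i\<bar>) = (\<Sum>i\<in>T - J. \<bar>z $ i\<bar>) + (\<Sum>i\<in>- J - T. \<bar>z $ i\<bar>)"
    "(\<Sum>i\<in>- T. \<bar>z $ i\<bar>) = (\<Sum>i\<in>J - T. \<bar>z $ i\<bar>) + (\<Sum>i\<in>- J - T. \<bar>z $ i\<bar>)"
    using sum.Int_Diff[of "- J" "\<lambda>i. \<bar>z $ i\<bar>" T] sum.Int_Diff[of "- T" "\<lambda>i. \<bar>z $ i\<bar>" J]
    by simp_all
  then show ?thesis using le by simp
qed

text \<open>The first \<open>K\<close> indices of a decreasing enumeration are one admissible
  choice, and the exchange inequality applied in both directions shows that ties do not affect the
  mass.\<close>

lemma sum_complement_largest_indices:
  fixes z :: "real ^ 'n"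
  assumes "largest_indices K z J"
  shows "(\<Sum>i\<in>- J. \<bar>z $ i\<bar>) = tail_mag K z"
proof -
  have K: "K \<le> CARD('n)"
    using assms card_mono[of UNIV J] by (auto simp: largest_indices_def)
  obtain \<sigma> where \<sigma>: "bij_betw \<sigma> {1..CARD('n)} UNIV"
    "\<And>k. 1 \<le> k \<Longrightarrow> k \<le> CARD('n) \<Longrightarrow> decr_mag z k = \<bar>z $ \<sigma> k\<bar>"
    "\<And>k l. 1 \<le> k \<Longrightarrow> k \<le> l \<Longrightarrow> l \<le> CARD('n) \<Longrightarrow> \<bar>z $ \<sigma> l\<bar> \<le> \<bar>z $ \<sigma> k\<bar>"
    by (rule decr_mag_enumeration[of z]) blast
  define T where "T = \<sigma> ` {1..K}"
  have inj: "inj_on \<sigma> {1..CARD('n)}" and im: "\<sigma> ` {1..CARD('n)} = UNIV"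
    using \<sigma>(1) by (auto simp: bij_betw_def)
  have cT: "card T = K"
    unfolding T_def using card_image[OF inj_on_subset[OF inj, of "{1..K}"]] K by simp
  have mT: "- T = \<sigma> ` {Suc K..CARD('n)}"
  proof -
    have "- T = \<sigma> ` ({1..CARD('n)} - {1..K})"
      unfolding T_def using inj_on_image_set_diff[OF inj, of "{1..CARD('n)}" "{1..K}"] im K
      by (auto simp: Compl_eq_Diff_UNIV)
    also have "{1..CARD('n)} - {1..K} = {Suc K..CARD('n)}" by auto
    finally show ?thesis .
  qed
  have big: "largest_indices K z T"
    unfolding largest_indices_def mT using cT \<sigma>(3) by (auto simp: T_def)
  have "(\<Sum>i\<in>- T. \<bar>z $ i\<bar>) = (\<Sum>k = Suc K..CARD('n). \<bar>z $ \<sigma> k\<bar>)"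
    unfolding mT using inj_on_subset[OF inj, of "{Suc K..CARD('n)}"]
    by (subst sum.reindex) auto
  also have "\<dots> = tail_mag K z"
    unfolding tail_mag_def by (intro sum.cong) (auto simp: \<sigma>(2))
  finally have "(\<Sum>i\<in>- T. \<bar>z $ i\<bar>) = tail_mag K z" .
  moreover have "(\<Sum>i\<in>- T. \<bar>z $ i\<bar>) = (\<Sum>i\<in>- J. \<bar>z $ i\<bar>)"
    using sum_complement_largest_indices_le[OF assms cT]
      sum_complement_largest_indices_le[OF big, of J] assms
    by (auto simp: largest_indices_def)
  ultimately show ?thesis by simp
qed

text \<open>With \<open>tail_mag_eq\<close> this makes the tail a minimum over
  \<open>K\<close>-sets: any convenient set bounds the tail of \<open>x\<close>, while an optimal
  one is taken for \<open>z\<close>.\<close>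

lemma tail_mag_le:
  fixes z :: "real ^ 'n"
  assumes "card T = K"
  shows "tail_mag K z \<le> (\<Sum>i\<in>- T. \<bar>z $ i\<bar>)"
proof -
  have "K \<le> CARD('n)" using assms card_mono[of UNIV T] by auto
  then obtain J where "largest_indices K z J"
    using largest_indices_exists by blast
  then show ?thesis
    using sum_complement_largest_indices sum_complement_largest_indices_le assms by metis
qed

lemma tail_mag_eq:
  fixes z :: "real ^ 'n"
  assumes "K \<le> CARD('n)"
  obtains T where "card T = K" "tail_mag K z = (\<Sum>i\<in>- T. \<bar>z $ i\<bar>)"
  using largest_indices_exists[OF assms, of z] sum_complement_largest_indices
  by (metis largest_indices_def)

lemma tail_mag_0: "tail_mag 0 z = l1_norm z"
  using sum_complement_largest_indices[of 0 z "{}"]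
  by (auto simp: largest_indices_def l1_norm_def)

lemma tail_mag_nonneg:
  fixes z :: "real ^ 'n"
  assumes "K \<le> CARD('n)"
  shows "0 \<le> tail_mag K z"
  by (rule tail_mag_eq[OF assms, of z]) (simp add: sum_nonneg)

lemma tail_mag_eq_0_iff:
  fixes z :: "real ^ 'n"
  assumes "K \<le> CARD('n)"
  shows "tail_mag K z = 0 \<longleftrightarrow> is_sparse K z"
proof
  assume "tail_mag K z = 0"
  then obtain T where T: "card T = K" "(\<Sum>i\<in>- T. \<bar>z $ i\<bar>) = 0"
    by (metis tail_mag_eq[OF assms])
  then have "{i. z $ i \<noteq> 0} \<subseteq> T" by (auto simp: sum_nonneg_eq_0_iff)
  then show "is_sparse K z" using T(1) card_mono[of T] by (auto simp: is_sparse_def)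
next
  assume "is_sparse K z"
  then obtain T where T: "{i. z $ i \<noteq> 0} \<subseteq> T" "card T = K"
    using exists_subset_between[of "{i. z $ i \<noteq> 0}" K UNIV] assms
    by (auto simp: is_sparse_def)
  then have "(\<Sum>i\<in>- T. \<bar>z $ i\<bar>) = 0" by (intro sum.neutral) auto
  then show "tail_mag K z = 0"
    using tail_mag_le[OF T(2), of z] tail_mag_nonneg[OF assms, of z] by simp
qed

section \<open>Penalties as nonnegative combinations of tail masses\<close>

text \<open>The weights rise by \<open>\<rho>\<close> at the first rank and by
  \<open>1 - \<rho>\<close> after rank \<open>K\<close>, hence the two coefficients.\<close>

lemma two_level_l1_eq_tail_mag:
  assumes "largest_indices K z (J z)"
  shows "two_level_l1 \<rho> J z = \<rho> * tail_mag 0 z + (1 - \<rho>) * tail_mag K z"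
proof -
  have "l1_norm z = (\<Sum>j\<in>J z. \<bar>z $ j\<bar>) + (\<Sum>j\<in>- J z. \<bar>z $ j\<bar>)"
    unfolding l1_norm_def by (simp add: sum.union_disjoint[symmetric] Compl_partition)
  then show ?thesis
    unfolding two_level_l1_def tail_mag_0 sum_complement_largest_indices[OF assms, symmetric]
    by (simp add: algebra_simps)
qed

text \<open>Abel summation; the convention \<open>b 0 = 0\<close> absorbs the boundary term.\<close>

lemma sum_by_parts:
  fixes b d :: "nat \<Rightarrow> real"
  assumes "b 0 = 0"
  shows "(\<Sum>k = 1..n. b k * d k) = (\<Sum>j<n. (b (Suc j) - b j) * (\<Sum>k = Suc j..n. d k))"
proof (induction n)
  case (Suc n)
  have "(\<Sum>j<Suc n. (b (Suc j) - b j) * (\<Sum>k = Suc j..Suc n. d k))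
    = (\<Sum>j<Suc n. (b (Suc j) - b j) * (\<Sum>k = Suc j..n. d k) + (b (Suc j) - b j) * d (Suc n))"
    by (intro sum.cong) (auto simp: distrib_left)
  also have "\<dots> = (\<Sum>j<n. (b (Suc j) - b j) * (\<Sum>k = Suc j..n. d k))
      + (\<Sum>j<Suc n. b (Suc j) - b j) * d (Suc n)"
    by (simp only: sum.distrib sum_distrib_right) simp
  also have "(\<Sum>j<Suc n. b (Suc j) - b j) = b (Suc n)"
    using assms by (simp add: sum_lessThan_telescope del: sum.lessThan_Suc)
  finally show ?case using Suc.IH by simp
qed simp

text \<open>The value \<open>\<beta> 0\<close> is unconstrained; overwriting it with zero makes the
  first increment equal to \<open>\<beta> 1\<close>.\<close>

lemma sorted_l1_eq_tail_mag:
  fixes z :: "real ^ 'n"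
  shows "sorted_l1 \<beta> z =
    (\<Sum>j<CARD('n). ((\<beta>(0 := 0)) (Suc j) - (\<beta>(0 := 0)) j) * tail_mag j z)"
proof -
  have "sorted_l1 \<beta> z = (\<Sum>k = 1..CARD('n). (\<beta>(0 := 0)) k * decr_mag z k)"
    unfolding sorted_l1_def by (intro sum.cong) auto
  then show ?thesis by (subst (asm) sum_by_parts) (simp_all add: tail_mag_def)
qed

lemma weight_increment_nonneg:
  fixes \<beta> :: "nat \<Rightarrow> real"
  assumes "0 \<le> \<beta> 1" and "\<And>k. 1 \<le> k \<Longrightarrow> k < n \<Longrightarrow> \<beta> k \<le> \<beta> (k + 1)" and "j < n"
  shows "0 \<le> (\<beta>(0 := 0)) (Suc j) - (\<beta>(0 := 0)) j"
  using assms by (cases j) auto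

lemma sorted_l1_mono:
  fixes x z :: "real ^ 'n"
  assumes "0 \<le> \<beta> 1" and "\<And>k. 1 \<le> k \<Longrightarrow> k < CARD('n) \<Longrightarrow> \<beta> k \<le> \<beta> (k + 1)"
    and "\<And>j. j < CARD('n) \<Longrightarrow> tail_mag j x \<le> tail_mag j z"
  shows "sorted_l1 \<beta> x \<le> sorted_l1 \<beta> z"
  unfolding sorted_l1_eq_tail_mag
  by (intro sum_mono mult_left_mono assms(3) weight_increment_nonneg[where n = "CARD('n)"])
    (use assms in auto)

text \<open>A strict tail inequality is felt only at a \<open>j\<close> where the weights really
  increase, since its coefficient is that increment.\<close>

lemma sorted_l1_strict_mono:
  fixes x z :: "real ^ 'n"
  assumes "0 \<le> \<beta> 1" and "\<And>k. 1 \<le> k \<Longrightarrow> k < CARD('n) \<Longrightarrow> \<beta> k \<le> \<beta> (k + 1)"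
    and "\<And>j. j < CARD('n) \<Longrightarrow> tail_mag j x \<le> tail_mag j z"
    and "j < CARD('n)" and "(\<beta>(0 := 0)) j < \<beta> (Suc j)" and "tail_mag j x < tail_mag j z"
  shows "sorted_l1 \<beta> x < sorted_l1 \<beta> z"
  unfolding sorted_l1_eq_tail_mag
proof (rule sum_strict_mono_ex1)
  show "\<forall>j\<in>{..<CARD('n)}. ((\<beta>(0 := 0)) (Suc j) - (\<beta>(0 := 0)) j) * tail_mag j x
    \<le> ((\<beta>(0 := 0)) (Suc j) - (\<beta>(0 := 0)) j) * tail_mag j z"
    by (intro ballI mult_left_mono assms(3) weight_increment_nonneg[where n = "CARD('n)"])
      (use assms in auto)
  show "\<exists>j\<in>{..<CARD('n)}. ((\<beta>(0 := 0)) (Suc j) - (\<beta>(0 := 0)) j) * tail_mag j x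
    < ((\<beta>(0 := 0)) (Suc j) - (\<beta>(0 := 0)) j) * tail_mag j z"
    by (rule bexI[of _ j], rule mult_strict_left_mono) (use assms(4-6) in auto)
qed simp

section \<open>Comparison of tails by exchange\<close>

text \<open>Bounding the gap below by a difference of masses of \<open>z - x\<close> serves both
  null space properties: whichever sign the property gives for \<open>W\<close>, weak or strict,
  passes to the tails.\<close>

lemma tail_mag_gap:
  fixes x z :: "real ^ 'n"
  assumes sp: "is_sparse s x" and js: "j \<le> s" and sN: "s \<le> CARD('n)"
  shows "\<exists>W. card W \<le> s \<and> l1_norm (vrestrict (z - x) (- W)) - l1_norm (vrestrict (z - x) W)
           \<le> tail_mag j z - tail_mag j x"
proof -
  define u where "u = (\<lambda>P. \<Sum>i\<in>P. \<bar>(z - x) $ i\<bar>)"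
  define b where "b = (\<lambda>P. \<Sum>i\<in>P. \<bar>z $ i\<bar>)"
  define a where "a = (\<lambda>P. \<Sum>i\<in>P. \<bar>x $ i\<bar>)"
  have un: "u (P \<union> Q) = u P + u Q" "b (P \<union> Q) = b P + b Q" "a (P \<union> Q) = a P + a Q"
    if "P \<inter> Q = {}" for P Q
    using that by (simp_all add: u_def b_def a_def sum.union_disjoint)
  have mono: "u P \<le> u Q" "b P \<le> b Q" if "P \<subseteq> Q" for P Q
    using that by (simp_all add: u_def b_def sum_mono2)
  have ab: "a P \<le> b P + u P" for P
    unfolding a_def b_def u_def sum.distrib[symmetric] by (intro sum_mono) auto
  obtain S where S: "{i. x $ i \<noteq> 0} \<subseteq> S" "card S = s"
    using exists_subset_between[of "{i. x $ i \<noteq> 0}" s UNIV] sp sN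
    by (auto simp: is_sparse_def)
  obtain T where T: "card T = j" "tail_mag j z = b (- T)"
    using tail_mag_eq[of j z] js sN unfolding b_def by (metis le_trans)
  define T1 where "T1 = T \<inter> S"
  define T2 where "T2 = T - S"
  have cT: "card T1 + card T2 = j"
    using card_Un_disjoint[of T1 T2] T(1) by (simp add: T1_def T2_def Int_Diff_disjoint Int_Diff_Un)
  \<comment> \<open>Since \<open>j \<le> s\<close>, there is room in \<open>S - T1\<close> for a
    stand-in \<open>Q\<close> for \<open>T2\<close>. The resulting \<open>j\<close>-subset
    \<open>T'\<close> of \<open>S\<close> is a competitor that bounds the tail of \<open>x\<close>
    from above.\<close>
  have "card (S - T1) = s - card T1"
    using S(2) by (simp add: T1_def card_Diff_subset)
  then obtain Q where Q: "Q \<subseteq> S - T1" "card Q = card T2"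
    using obtain_subset_with_card_n[of "card T2" "S - T1"] cT js
    by (metis add_le_imp_le_diff add.commute)
  define T' where "T' = T1 \<union> Q"
  have cT': "card T' = j"
    unfolding T'_def using Q cT by (subst card_Un_disjoint) auto
  have T'S: "T' \<subseteq> S" using Q by (auto simp: T'_def T1_def)
  have "a (- S) = 0" unfolding a_def using S(1) by (intro sum.neutral) auto
  moreover have "- T' = (S - T') \<union> - S" using T'S by auto
  ultimately have "a (- T') = a (S - T')" using un(3)[of "S - T'" "- S"] by auto
  then have tx: "tail_mag j x \<le> a (S - T')"
    using tail_mag_le[OF cT', of x] by (simp add: a_def)
  have "- T = (S - T1) \<union> (- S - T2)" by (auto simp: T1_def T2_def)
  then have "b (- T) = b (S - T1) + b (- S - T2)" using un(2)[of "S - T1" "- S - T2"] by auto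
  \<comment> \<open>Off \<open>S\<close> the vector \<open>x\<close> vanishes, so \<open>z\<close>
    and \<open>z - x\<close> agree; on \<open>S - T'\<close> the triangle inequality
    \<open>ab\<close> trades the masses of \<open>x\<close> and \<open>z\<close> for that of
    \<open>z - x\<close>.\<close>
  moreover have "b (- S - T2) = u (- S - T2)"
    unfolding b_def u_def using S(1) by (intro sum.cong) force+
  moreover have "b (S - T') \<le> b (S - T1)" by (rule mono) (auto simp: T'_def)
  ultimately have gap: "u (- S - T2) - u (S - T') \<le> tail_mag j z - tail_mag j x"
    using T(2) tx ab[of "S - T'"] by simp
  have S_dec: "u S = u (S - T') + u T'"
    using un(1)[of "S - T'" T'] T'S by (simp add: Un_absorb2 Int_commute Diff_disjoint)
  have "- S = (- S - T2) \<union> T2" by (auto simp: T2_def)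
  then have cS_dec: "u (- S) = u (- S - T2) + u T2"
    using un(1)[of "- S - T2" T2] by auto
  \<comment> \<open>The bound \<open>gap\<close> leaves out \<open>T2\<close> and \<open>T'\<close>.
    If \<open>T2\<close> has no more \<open>u\<close>-mass than \<open>T'\<close>, putting both back
    cannot raise the difference, and \<open>W = S\<close> works. Otherwise \<open>T2\<close>
    replaces \<open>Q\<close> in \<open>S\<close>.\<close>
  show ?thesis
  proof (cases "u T2 \<le> u T'")
    case True
    then have "u (- S) - u S \<le> tail_mag j z - tail_mag j x"
      using gap S_dec cS_dec by simp
    then show ?thesis using S(2) by (auto simp: l1_norm_vrestrict u_def)
  next
    case False
    define W where "W = (S - Q) \<union> T2"
    have QT: "u Q \<le> u T'" by (rule mono) (simp add: T'_def)
    have ST: "u (S - T') \<le> u (S - Q)" by (rule mono) (auto simp: T'_def)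
    have W: "u W = u (S - Q) + u T2"
      unfolding W_def by (rule un) (auto simp: T2_def)
    have "- W = (- S - T2) \<union> Q" using Q(1) by (auto simp: W_def T2_def)
    then have cW: "u (- W) = u (- S - T2) + u Q"
      using un(1)[of "- S - T2" Q] Q(1) by auto
    have "card W \<le> card (S - Q) + card T2" unfolding W_def by (rule card_Un_le)
    also have "\<dots> = s"
    proof -
      have "Q \<subseteq> S" using Q(1) by auto
      then show ?thesis
        using Q(2) S(2) card_mono[of S Q] by (simp add: card_Diff_subset)
    qed
    finally have "card W \<le> s" .
    moreover have "u (- W) - u W \<le> tail_mag j z - tail_mag j x"
      using gap W cW QT ST False by simp
    ultimately show ?thesis by (auto simp: l1_norm_vrestrict u_def)
  qed
qed

lemma tail_mag_mono:
  fixes x z :: "real ^ 'n"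
  assumes "is_sparse s x" and "s \<le> CARD('n)" and "j \<le> CARD('n)"
    and "\<And>W. card W \<le> s \<Longrightarrow>
      l1_norm (vrestrict (z - x) W) \<le> l1_norm (vrestrict (z - x) (- W))"
  shows "tail_mag j x \<le> tail_mag j z"
proof (cases "j \<le> s")
  case True
  then show ?thesis using tail_mag_gap[OF assms(1) True assms(2), of z] assms(4) by force
next
  case False
  then have "is_sparse j x" using assms(1) by (simp add: is_sparse_def)
  then show ?thesis
    using tail_mag_eq_0_iff[OF assms(3), of x] tail_mag_nonneg[OF assms(3), of z] by simp
qed

lemma tail_mag_strict_mono:
  fixes x z :: "real ^ 'n"
  assumes "is_sparse s x" and "s \<le> CARD('n)" and "j \<le> s"
    and "\<And>W. card W \<le> s \<Longrightarrow>
      l1_norm (vrestrict (z - x) W) < l1_norm (vrestrict (z - x) (- W))"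
  shows "tail_mag j x < tail_mag j z"
  using tail_mag_gap[OF assms(1,3,2), of z] assms(4) by force

section \<open>Rigidity under the improved null space property\<close>

text \<open>A support of at most \<open>2 * s\<close> indices can be cut so that both sides have at
  most \<open>s\<close>, which forces equal masses. Fewer than \<open>2 * s\<close> indices would
  leave room to move one more across and break the balance; with exactly \<open>2 * s\<close>,
  swapping two indices between balanced halves compares their magnitudes.\<close>

lemma balanced_support:
  fixes v :: "real ^ 'n"
  assumes nsp: "\<And>W. card W \<le> s \<Longrightarrow> l1_norm (vrestrict v W) \<le> l1_norm (vrestrict v (- W))"
    and "v \<noteq> 0" and cV: "card {i. v $ i \<noteq> 0} \<le> 2 * s"
  shows "card {i. v $ i \<noteq> 0} = 2 * s" and "equal_height v"
proof -
  define V where "V = {i. v $ i \<noteq> 0}"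
  define u where "u = (\<lambda>P. \<Sum>i\<in>P. \<bar>v $ i\<bar>)"
  have Vne: "V \<noteq> {}" using assms(2) by (auto simp: V_def vec_eq_iff)
  have split: "u W \<le> u W'" if "V = W \<union> W'" "card W \<le> s" for W W'
  proof -
    have "u (- W) \<le> u (- W \<inter> V)"
      unfolding u_def by (rule eq_refl, rule sum.mono_neutral_right) (auto simp: V_def)
    also have "\<dots> \<le> u W'" unfolding u_def by (rule sum_mono2) (use that in auto)
    finally show ?thesis using nsp[OF that(2)] by (simp add: u_def l1_norm_vrestrict)
  qed
  have ins: "u (insert i P) = u P + \<bar>v $ i\<bar>" if "i \<notin> P" for i P
    using that by (simp add: u_def)
  show card: "card {i. v $ i \<noteq> 0} = 2 * s"
  proof (rule ccontr)
    assume "card {i. v $ i \<noteq> 0} \<noteq> 2 * s"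
    then have lt: "card V < 2 * s" using cV by (simp add: V_def)
    obtain W where W: "W \<subseteq> V" "card W = card V div 2"
      using obtain_subset_with_card_n[of "card V div 2" V] by auto
    have cD: "card (V - W) = card V - card V div 2" using W by (simp add: card_Diff_subset)
    moreover have "card V > 0" using Vne by (simp add: card_gt_0_iff)
    ultimately have "card (V - W) > 0" by simp
    then obtain j where j: "j \<in> V" "j \<notin> W" by (auto simp: card_gt_0_iff)
    \<comment> \<open>Both sides have at most \<open>s\<close> indices, and because
      \<open>card V < 2 * s\<close> the smaller half \<open>W\<close> stays admissible after gaining
      \<open>j\<close>. Together the inequalities force \<open>v $ j = 0\<close>.\<close>
    have "u (V - W) \<le> u W" by (rule split) (use W cD lt in auto)
    moreover have "u (insert j W) \<le> u (V - W - {j})"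
      by (rule split) (use W j lt in auto)
    moreover have "u (V - W) = u (V - W - {j}) + \<bar>v $ j\<bar>"
      using ins[of j "V - W - {j}"] j by (simp add: insert_absorb)
    ultimately show False using ins[OF j(2)] j(1) by (simp add: V_def)
  qed
  show "equal_height v"
    unfolding equal_height_def
  proof (intro allI impI)
    fix i j assume ij: "v $ i \<noteq> 0" "v $ j \<noteq> 0"
    show "\<bar>v $ i\<bar> = \<bar>v $ j\<bar>"
    proof (cases "i = j")
      case False
      define V' where "V' = V - {i, j}"
      have cV': "card V' = 2 * s - 2"
        using card False ij by (simp add: V'_def V_def card_Diff_subset)
      have "2 * s > 0" using card Vne by (metis V_def card_gt_0_iff finite)
      then have s: "s \<ge> 1" by simp
      obtain W where W: "W \<subseteq> V'" "card W = s - 1"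
        using obtain_subset_with_card_n[of "s - 1" V'] cV' s
        by (metis diff_le_mono mult_2 le_add1 diff_mult_distrib2 mult.right_neutral)
      define W' where "W' = V' - W"
      have cW': "card W' = s - 1" using W cV' by (simp add: W'_def card_Diff_subset)
      have V: "V = insert k W \<union> insert l W'" "V = insert k W' \<union> insert l W"
        if "{k, l} = {i, j}" for k l
        using that ij W(1) by (auto simp: W'_def V'_def V_def)
      \<comment> \<open>Each side has exactly \<open>s\<close> indices, so \<open>split\<close>
        applies in both directions. Using both assignments of \<open>i\<close> and \<open>j\<close>
        and subtracting removes \<open>u W\<close> and \<open>u W'\<close>.\<close>
      have eq: "u (insert k W) = u (insert l W')" if "{k, l} = {i, j}" for k l
      proof (rule antisym)
        show "u (insert k W) \<le> u (insert l W')"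
          using W(2) s by (intro split[OF V(1)[OF that]]) (simp add: card_insert_if)
        have "{l, k} = {i, j}" using that by auto
        then show "u (insert l W') \<le> u (insert k W)"
          using cW' s by (intro split[OF V(2)]) (simp_all add: card_insert_if)
      qed
      have "i \<notin> W" "j \<notin> W" "i \<notin> W'" "j \<notin> W'" using W(1) by (auto simp: W'_def V'_def)
      then have "u W + \<bar>v $ i\<bar> = u W' + \<bar>v $ j\<bar>" "u W + \<bar>v $ j\<bar> = u W' + \<bar>v $ i\<bar>"
        using eq[of i j] eq[of j i] by (simp_all add: ins insert_commute)
      then show ?thesis by simp
    qed simp
  qed
qed

text \<open>The support of \<open>z - x\<close> lies in the union of two supports of size at most
  \<open>s\<close>; having \<open>2 * s\<close> elements, it forces them to be disjoint. Thus
  \<open>z - x\<close> equals \<open>-x\<close> on the support of \<open>x\<close>, which inherits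
  equal height.\<close>

lemma equal_height_if_both_sparse:
  fixes x z :: "real ^ 'n"
  assumes "\<And>W. card W \<le> s \<Longrightarrow>
      l1_norm (vrestrict (z - x) W) \<le> l1_norm (vrestrict (z - x) (- W))"
    and "z \<noteq> x" and "is_sparse s x" and "is_sparse s z"
  shows "equal_height x"
proof -
  let ?X = "{i. x $ i \<noteq> 0}" and ?Z = "{i. z $ i \<noteq> 0}" and ?V = "{i. (z - x) $ i \<noteq> 0}"
  have c: "card ?X \<le> s" "card ?Z \<le> s" using assms(3,4) by (auto simp: is_sparse_def)
  have V: "card ?V \<le> card (?X \<union> ?Z)" by (rule card_mono) auto
  have Un: "card (?X \<union> ?Z) + card (?X \<inter> ?Z) = card ?X + card ?Z"
    by (rule card_Un_Int[symmetric]) simp_all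
  have le: "card ?V \<le> 2 * s" using V Un c by linarith
  have ne: "z - x \<noteq> 0" using assms(2) by simp
  note bal = balanced_support[OF assms(1) ne le]
  have "card (?X \<inter> ?Z) = 0"
    using bal(1) V Un c by linarith
  then have "?X \<inter> ?Z = {}" by simp
  then have z0: "z $ i = 0" if "x $ i \<noteq> 0" for i using that by auto
  show ?thesis
    unfolding equal_height_def
  proof (intro allI impI)
    fix i j assume ij: "x $ i \<noteq> 0" "x $ j \<noteq> 0"
    then show "\<bar>x $ i\<bar> = \<bar>x $ j\<bar>"
      using bal(2)[unfolded equal_height_def, rule_format, of i j] z0 by simp
  qed
qed

section \<open>Linearization of the l1 - l2 penalty\<close>

text \<open>Cauchy-Schwarz for rearranged vectors. Equality would make them proportional, so a
  permutation would map the support of \<open>z\<close> into that of \<open>x\<close>, against the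
  sparsity assumptions.\<close>

lemma decr_mag_inner_less:
  fixes x z :: "real ^ 'n"
  assumes "x \<noteq> 0" and "is_sparse s x" and "\<not> is_sparse s z"
  shows "(\<Sum>k = 1..CARD('n). decr_mag z k * decr_mag x k) < norm z * norm x"
proof -
  obtain \<sigma> where \<sigma>: "bij_betw \<sigma> {1..CARD('n)} UNIV"
    "\<And>k. 1 \<le> k \<Longrightarrow> k \<le> CARD('n) \<Longrightarrow> decr_mag z k = \<bar>z $ \<sigma> k\<bar>"
    by (rule decr_mag_enumeration[of z]) blast
  obtain \<tau> where \<tau>: "bij_betw \<tau> {1..CARD('n)} UNIV"
    "\<And>k. 1 \<le> k \<Longrightarrow> k \<le> CARD('n) \<Longrightarrow> decr_mag x k = \<bar>x $ \<tau> k\<bar>"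
    by (rule decr_mag_enumeration[of x]) blast
  \<comment> \<open>\<open>\<pi>\<close> sends the index of rank \<open>k\<close> in
    \<open>z\<close> to the index of rank \<open>k\<close> in \<open>x\<close>.\<close>
  define \<pi> where "\<pi> = \<tau> \<circ> the_inv_into {1..CARD('n)} \<sigma>"
  have bij: "bij \<pi>"
    unfolding \<pi>_def using \<tau>(1) bij_betw_the_inv_into[OF \<sigma>(1)] by (rule bij_betw_trans[rotated])
  have \<pi>: "\<pi> (\<sigma> k) = \<tau> k" if "k \<in> {1..CARD('n)}" for k
    using that \<sigma>(1) by (simp add: \<pi>_def bij_betw_def the_inv_into_f_f)
  define z' where "z' = (\<chi> i. \<bar>z $ i\<bar>)"
  define x' where "x' = (\<chi> i. \<bar>x $ \<pi> i\<bar>)"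
  have nz: "norm z' = norm z" by (simp add: z'_def norm_vec_def)
  have nx: "norm x' = norm x"
    unfolding norm_vec_def L2_set_def x'_def
    using sum.reindex_bij_betw[OF bij, of "\<lambda>i. (norm (x $ i))\<^sup>2"] by simp
  have "(\<Sum>k = 1..CARD('n). decr_mag z k * decr_mag x k)
      = (\<Sum>k = 1..CARD('n). z' $ \<sigma> k * x' $ \<sigma> k)"
    by (intro sum.cong) (auto simp: z'_def x'_def \<sigma>(2) \<tau>(2) \<pi>)
  also have "\<dots> = z' \<bullet> x'"
    unfolding inner_vec_def using sum.reindex_bij_betw[OF \<sigma>(1), of "\<lambda>i. z' $ i * x' $ i"] by simp
  finally have ip: "(\<Sum>k = 1..CARD('n). decr_mag z k * decr_mag x k) = z' \<bullet> x'" .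
  have "z' \<bullet> x' \<noteq> norm z' * norm x'"
  proof
    assume "z' \<bullet> x' = norm z' * norm x'"
    then have "norm z' *\<^sub>R x' = norm x' *\<^sub>R z'"
      using norm_cauchy_schwarz_eq by blast
    then have "norm z * \<bar>x $ \<pi> i\<bar> = norm x * \<bar>z $ i\<bar>" for i
      unfolding nz nx by (simp add: vec_eq_iff z'_def x'_def)
    then have "z $ i \<noteq> 0 \<Longrightarrow> x $ \<pi> i \<noteq> 0" for i
      using assms(1) by (metis abs_eq_0 mult_eq_0_iff norm_eq_zero)
    then have "\<pi> ` {i. z $ i \<noteq> 0} \<subseteq> {i. x $ i \<noteq> 0}" by auto
    then have "card (\<pi> ` {i. z $ i \<noteq> 0}) \<le> card {i. x $ i \<noteq> 0}" by (intro card_mono) auto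
    moreover have "card (\<pi> ` {i. z $ i \<noteq> 0}) = card {i. z $ i \<noteq> 0}"
      using bij by (intro card_image) (metis bij_is_inj inj_on_subset subset_UNIV)
    ultimately show False using assms(2,3) by (simp add: is_sparse_def)
  qed
  then show ?thesis
    using norm_cauchy_schwarz[of z' x'] ip nz nx by simp
qed

lemma sum_decr_mag:
  fixes z :: "real ^ 'n"
  shows "(\<Sum>k = 1..CARD('n). decr_mag z k) = l1_norm z"
  using tail_mag_0[of z] by (simp add: tail_mag_def)

lemma sum_decr_mag_square:
  fixes z :: "real ^ 'n"
  shows "(\<Sum>k = 1..CARD('n). (decr_mag z k)\<^sup>2) = (norm z)\<^sup>2"
proof -
  obtain \<sigma> where \<sigma>: "bij_betw \<sigma> {1..CARD('n)} UNIV"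
    "\<And>k. 1 \<le> k \<Longrightarrow> k \<le> CARD('n) \<Longrightarrow> decr_mag z k = \<bar>z $ \<sigma> k\<bar>"
    by (rule decr_mag_enumeration[of z]) blast
  have "(\<Sum>k = 1..CARD('n). (decr_mag z k)\<^sup>2) = (\<Sum>k = 1..CARD('n). (z $ \<sigma> k)\<^sup>2)"
    by (intro sum.cong) (auto simp: \<sigma>(2))
  also have "\<dots> = (\<Sum>i\<in>UNIV. (z $ i)\<^sup>2)"
    using sum.reindex_bij_betw[OF \<sigma>(1), of "\<lambda>i. (z $ i)\<^sup>2"] by simp
  finally show ?thesis
    by (simp add: norm_vec_def L2_set_def sum_nonneg)
qed

lemma decr_mag_le_norm:
  fixes z :: "real ^ 'n"
  assumes "1 \<le> k" "k \<le> CARD('n)"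
  shows "decr_mag z k \<le> norm z"
proof -
  obtain \<sigma> where "bij_betw \<sigma> {1..CARD('n)} UNIV"
    "\<And>k. 1 \<le> k \<Longrightarrow> k \<le> CARD('n) \<Longrightarrow> decr_mag z k = \<bar>z $ \<sigma> k\<bar>"
    by (rule decr_mag_enumeration[of z]) blast
  then show ?thesis using assms component_le_norm_cart[of z "\<sigma> k"] by simp
qed

text \<open>
  The weights \<open>\<beta>\<close> in the proof are the gradient of the concave penalty at \<open>z\<close>, in decreasing
  coordinates.
\<close>

lemma l1_minus_l2_strict_mono:
  fixes x z :: "real ^ 'n"
  assumes "\<And>j. j < CARD('n) \<Longrightarrow> tail_mag j x \<le> tail_mag j z"
    and "x \<noteq> 0" and "is_sparse s x" and "\<not> is_sparse s z"
  shows "l1_minus_l2 x < l1_minus_l2 z"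
proof -
  define \<beta> where "\<beta> k = 1 - decr_mag z k / norm z" for k
  have "z \<noteq> 0" using assms(4) by (auto simp: is_sparse_def)
  then have nz: "norm z > 0" by simp
  have s: "sorted_l1 \<beta> y = l1_norm y - (\<Sum>k = 1..CARD('n). decr_mag z k * decr_mag y k) / norm z"
    for y :: "real ^ 'n"
    unfolding sorted_l1_def \<beta>_def
    by (simp add: left_diff_distrib sum_subtractf sum_divide_distrib flip: sum_decr_mag)
  have le: "sorted_l1 \<beta> x \<le> sorted_l1 \<beta> z"
  proof (rule sorted_l1_mono)
    show "0 \<le> \<beta> 1" using decr_mag_le_norm[of 1 z] nz by (simp add: \<beta>_def)
    show "\<beta> k \<le> \<beta> (k + 1)" if "1 \<le> k" "k < CARD('n)" for k
      using decr_mag_antimono[of k "k + 1" z] that nz by (simp add: \<beta>_def divide_right_mono)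
  qed (rule assms(1))
  \<comment> \<open>The linearized penalty agrees with the original at \<open>z\<close> and strictly
    exceeds it at \<open>x\<close> by \<open>decr_mag_inner_less\<close>; so its weak monotonicity
    yields a strict conclusion.\<close>
  have "(\<Sum>k = 1..CARD('n). decr_mag z k * decr_mag z k) = norm z * norm z"
    using sum_decr_mag_square[of z] by (simp add: power2_eq_square)
  then have "sorted_l1 \<beta> z = l1_minus_l2 z"
    unfolding s l1_minus_l2_def using nz by simp
  moreover have "l1_minus_l2 x < sorted_l1 \<beta> x"
    unfolding s l1_minus_l2_def
    using decr_mag_inner_less[OF assms(2-4)] nz by (simp add: divide_less_eq mult.commute)
  ultimately show ?thesis using le by simp
qed

section \<open>Recovery statements from the tail comparisons\<close>

theorem proposition3p2:
  fixes A :: "real ^ 'n ^ 'm" and s :: nat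
  assumes "CARD('n) > 1"
    and "1 \<le> s" and "real s < real CARD('n) / 2"
  shows
    "(\<forall>(\<rho> :: real) (K :: nat) (J :: real ^ 'n \<Rightarrow> 'n set).
        0 \<le> \<rho> \<longrightarrow> \<rho> < 1 \<longrightarrow> K \<le> CARD('n) \<longrightarrow> (\<forall>z. largest_indices K z (J z)) \<longrightarrow>
        (0 < \<rho> \<or> K \<le> s) \<longrightarrow>
        null_space_property s A \<longrightarrow>
        (\<forall>x. is_sparse s x \<longrightarrow> unique_solution A (two_level_l1 \<rho> J) x)) \<and>
     (\<forall>\<beta> :: nat \<Rightarrow> real.
        0 \<le> \<beta> 1 \<longrightarrow> (\<forall>k. 1 \<le> k \<and> k < CARD('n) \<longrightarrow> \<beta> k \<le> \<beta> (k + 1)) \<longrightarrow> \<beta> (s + 1) > 0 \<longrightarrow>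
        null_space_property s A \<longrightarrow>
        (\<forall>x. is_sparse s x \<longrightarrow> unique_solution A (sorted_l1 \<beta>) x)) \<and>
     (improved_null_space_property s A \<longrightarrow>
        (\<forall>x. is_sparse s x \<longrightarrow> \<not> equal_height x \<longrightarrow> unique_solution A l1_minus_l2 x)) \<and>
     (\<forall>\<beta> :: nat \<Rightarrow> real.
        0 \<le> \<beta> 1 \<longrightarrow> (\<forall>k. 1 \<le> k \<and> k < CARD('n) \<longrightarrow> \<beta> k \<le> \<beta> (k + 1)) \<longrightarrow> \<beta> (s + 1) > \<beta> s \<longrightarrow>
        improved_null_space_property s A \<longrightarrow>
        (\<forall>x. is_sparse s x \<longrightarrow> \<not> equal_height x \<longrightarrow> unique_solution A (sorted_l1 \<beta>) x))"
proof -
  have sN: "s < CARD('n)" using assms(3) by linarith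
  have ker: "z - x \<in> matrix_ker A - {0}" if "z \<noteq> x" "A *v z = A *v x" for x z
    using that by (simp add: matrix_ker_def matrix_vector_mult_diff_distrib)
  have strict: "tail_mag j x < tail_mag j z"
    if "null_space_property s A" "is_sparse s x" "z \<noteq> x" "A *v z = A *v x" "j \<le> s" for x z j
    using that ker[OF that(3,4)] sN
    by (intro tail_mag_strict_mono[where s = s]) (auto simp: null_space_property_def)
  have imp: "l1_norm (vrestrict (z - x) W) \<le> l1_norm (vrestrict (z - x) (- W))"
    if "improved_null_space_property s A" "z \<noteq> x" "A *v z = A *v x" "card W \<le> s" for x z W
    using that ker[OF that(2,3)] by (auto simp: improved_null_space_property_def)
  have weak: "tail_mag j x \<le> tail_mag j z"
    if "improved_null_space_property s A" "is_sparse s x" "z \<noteq> x" "A *v z = A *v x"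
      "j \<le> CARD('n)" for x z j
    using that imp[OF that(1,3,4)] sN by (intro tail_mag_mono[where s = s]) auto
  have nsp_imp: "improved_null_space_property s A" if "null_space_property s A"
    using that by (fastforce simp: null_space_property_def improved_null_space_property_def)
  have dense: "\<not> is_sparse s z"
    if "improved_null_space_property s A" "is_sparse s x" "\<not> equal_height x"
      "z \<noteq> x" "A *v z = A *v x" for x z
    using equal_height_if_both_sparse[OF imp[OF that(1,4,5)]] that by blast
  have two_level: "unique_solution A (two_level_l1 \<rho> J) x"
    if "0 \<le> \<rho>" "\<rho> < 1" "K \<le> CARD('n)" "\<forall>z. largest_indices K z (J z)" "0 < \<rho> \<or> K \<le> s"
      "null_space_property s A" "is_sparse s x" for \<rho> K J x
    unfolding unique_solution_def
  proof (intro allI impI)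
    fix z assume z: "z \<noteq> x" "A *v z = A *v x"
    have 0: "tail_mag 0 x < tail_mag 0 z" using strict[OF that(6,7) z] by simp
    have K: "tail_mag K x \<le> tail_mag K z"
      using weak[OF nsp_imp[OF that(6)] that(7) z that(3)] .
    \<comment> \<open>Strictness comes from the full mass if \<open>\<rho> > 0\<close>, and
      otherwise from the tail at \<open>K \<le> s\<close>, whose coefficient
      \<open>1 - \<rho>\<close> is positive.\<close>
    have "\<rho> * tail_mag 0 x + (1 - \<rho>) * tail_mag K x < \<rho> * tail_mag 0 z + (1 - \<rho>) * tail_mag K z"
      using that(5)
    proof
      assume "0 < \<rho>"
      then show ?thesis using 0 K that(2)
        by (intro add_less_le_mono mult_strict_left_mono mult_left_mono) auto
    next
      assume "K \<le> s"
      then have "tail_mag K x < tail_mag K z" by (rule strict[OF that(6,7) z])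
      then show ?thesis using 0 that(1,2)
        by (intro add_le_less_mono mult_strict_left_mono mult_left_mono) auto
    qed
    then show "two_level_l1 \<rho> J x < two_level_l1 \<rho> J z"
      by (simp only: two_level_l1_eq_tail_mag[OF that(4)[rule_format]])
  qed
  have sorted_nsp: "unique_solution A (sorted_l1 \<beta>) x"
    if "0 \<le> \<beta> 1" "\<forall>k. 1 \<le> k \<and> k < CARD('n) \<longrightarrow> \<beta> k \<le> \<beta> (k + 1)" "\<beta> (s + 1) > 0"
      "null_space_property s A" "is_sparse s x" for \<beta> x
    unfolding unique_solution_def
  proof (intro allI impI)
    fix z assume z: "z \<noteq> x" "A *v z = A *v x"
    \<comment> \<open>Weights that start from zero and never increase up to rank
      \<open>s + 1\<close> would give \<open>\<beta> (s + 1) \<le> 0\<close>.\<close>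
    have "\<exists>j\<le>s. (\<beta>(0 := 0)) j < \<beta> (Suc j)"
    proof (rule ccontr)
      assume *: "\<not> ?thesis"
      have "\<beta> (Suc j) \<le> 0" if "j \<le> s" for j
        using that * by (induction j) (force simp: not_less)+
      from this[of s] show False using that(3) by simp
    qed
    then obtain j where j: "j \<le> s" "(\<beta>(0 := 0)) j < \<beta> (Suc j)" by blast
    show "sorted_l1 \<beta> x < sorted_l1 \<beta> z"
    proof (rule sorted_l1_strict_mono[where j = j])
      show "tail_mag j x \<le> tail_mag j z" if "j < CARD('n)" for j
        using weak[OF nsp_imp[OF \<open>null_space_property s A\<close>] \<open>is_sparse s x\<close> z] that by simp
      show "tail_mag j x < tail_mag j z" by (rule strict[OF that(4,5) z j(1)])
    qed (use that j sN in auto)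
  qed
  have l12: "unique_solution A l1_minus_l2 x"
    if "improved_null_space_property s A" "is_sparse s x" "\<not> equal_height x" for x
    unfolding unique_solution_def
  proof (intro allI impI)
    fix z assume z: "z \<noteq> x" "A *v z = A *v x"
    \<comment> \<open>The zero vector is vacuously equal-height.\<close>
    have "x \<noteq> 0" using that(3) by (auto simp: equal_height_def)
    then show "l1_minus_l2 x < l1_minus_l2 z"
      using weak[OF that(1,2) z] dense[OF that z] that(2)
      by (intro l1_minus_l2_strict_mono[where s = s]) auto
  qed
  have sorted_insp: "unique_solution A (sorted_l1 \<beta>) x"
    if "0 \<le> \<beta> 1" "\<forall>k. 1 \<le> k \<and> k < CARD('n) \<longrightarrow> \<beta> k \<le> \<beta> (k + 1)" "\<beta> (s + 1) > \<beta> s"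
      "improved_null_space_property s A" "is_sparse s x" "\<not> equal_height x" for \<beta> x
    unfolding unique_solution_def
  proof (intro allI impI)
    fix z assume z: "z \<noteq> x" "A *v z = A *v x"
    \<comment> \<open>The strict inequality is taken at \<open>j = s\<close>, where \<open>x\<close>
      has no tail left but \<open>z\<close> does. There the increment is
      \<open>\<beta> (s + 1) - \<beta> s\<close>, because \<open>1 \<le> s\<close> keeps
      \<open>s\<close> away from the overwritten index \<open>0\<close>.\<close>
    have "tail_mag s x = 0" "tail_mag s z \<noteq> 0"
      using tail_mag_eq_0_iff[of s x] tail_mag_eq_0_iff[of s z] sN that(5) dense[OF that(4-6) z]
      by auto
    then have gap: "tail_mag s x < tail_mag s z"
      using tail_mag_nonneg[of s z] sN by simp
    show "sorted_l1 \<beta> x < sorted_l1 \<beta> z"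
    proof (rule sorted_l1_strict_mono[where j = s])
      show "tail_mag j x \<le> tail_mag j z" if "j < CARD('n)" for j
        using weak[OF \<open>improved_null_space_property s A\<close> \<open>is_sparse s x\<close> z] that by simp
    qed (use that gap sN assms(2) in auto)
  qed
  show ?thesis
    by (intro conjI allI impI; (rule two_level sorted_nsp l12 sorted_insp; assumption))
qed

end
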